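(* Let $a,s,b$ be three distinct vertices of the randomly oriented complete graph $K_n$, and let $A=\{a\nrightarrow s\}$ and $B=\{s\nrightarrow b\}$. Then $$\lim_{n\to\infty}\frac{P(A\cap B)-P(A)\cdot P(B)}{P(A\cap B)}=\frac13.$$
   Context: The complete graph $K_n$ on the vertex set $[n]=\{1,\dots,n\}$ is randomly oriented: each edge is independently given one of its two possible directions, each with probability $\frac12$. For vertices $u\neq v$, $\{u\to v\}$ is the event that there is a directed path from $u$ to $v$, and $\{u\nrightarrow v\}$ is its complement. $P$ is the probability for this random orientation of $K_n$ (so $P(A)$, $P(B)$, $P(A\cap B)$ depend on $n$, defined for $n\ge 3$, and not on the choice of the distinct vertices). *)

theory Defs
  imports "HOL-Probability.Probability" "Graph_Theory.Graph_Theory"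
begin

definition complete_edges :: "nat \<Rightarrow> nat set set" where
  "complete_edges n = {e. e \<subseteq> {1..n} \<and> card e = 2}"

(* An orientation assigns to each edge its head, so the choice for the edge {u, v} is uniform
   on {u, v}; Pi_pmf makes the choices independent. Off the edge set it takes the dummy value 0. *)
definition random_orientation :: "nat \<Rightarrow> (nat set \<Rightarrow> nat) pmf" where
  "random_orientation n = Pi_pmf (complete_edges n) 0 (\<lambda>e. pmf_of_set e)"

definition oriented_graph :: "nat \<Rightarrow> (nat set \<Rightarrow> nat) \<Rightarrow> nat pair_pre_digraph" where
  "oriented_graph n \<omega> =
     \<lparr> pverts = {1..n}, parcs = {(u, v). {u, v} \<in> complete_edges n \<and> \<omega> {u, v} = v} \<rparr>"

definition path_event :: "nat \<Rightarrow> nat \<Rightarrow> nat \<Rightarrow> (nat set \<Rightarrow> nat) set" where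
  "path_event n u v =
     {\<omega>. \<exists>p. pre_digraph.apath (with_proj (oriented_graph n \<omega>)) u p v}"

definition no_path_event :: "nat \<Rightarrow> nat \<Rightarrow> nat \<Rightarrow> (nat set \<Rightarrow> nat) set" where
  "no_path_event n u v = - path_event n u v"

end

theory Submission
  imports Defs "HOL-Real_Asymp.Real_Asymp"
begin

text \<open>
  Both \<open>A\<close> and \<open>A \<inter> B\<close> say that every step of a chain \<open>v 0, \<dots>, v l\<close> of distinct vertices is
  blocked: no \<open>v i\<close> reaches \<open>v (Suc i)\<close>, where \<open>l = 1\<close> for \<open>A\<close> and for \<open>B\<close>, and \<open>l = 2\<close> for
  \<open>A \<inter> B\<close>. Let \<open>R i\<close> be the set of vertices that \<open>v i\<close> reaches. The edge between \<open>v i\<close> and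
  \<open>v (Suc i)\<close> has to point back to \<open>v i\<close>, so the sets \<open>R i\<close> increase with \<open>i\<close>. Labelling each vertex
  with the first \<open>i\<close> such that it lies in \<open>R i\<close> (with \<open>l\<close> if there is none) gives a labelling by
  \<open>{..l}\<close> in which \<open>v i\<close> has label \<open>i\<close> and no arc increases the label; conversely, such a labelling
  blocks every step. The chain event is therefore the union, over all labellings that extend
  \<open>v i \<mapsto> i\<close>, of the events that all edges between distinct labels point to the smaller label. Such an
  event has probability \<open>2\<close> to the minus the number of these crossing edges.

  Few crossing edges are possible only if almost all vertices have the same label. If all vertices
  outside the chain have label \<open>c\<close>, there are \<open>q = (l choose 2) + l (n - l)\<close> crossing edges, whatever
  \<open>c\<close> is. There are \<open>l + 1\<close> choices of \<open>c\<close>, and the corresponding events hardly overlap, so together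
  they contribute about \<open>(l + 1) / 2 ^ q\<close>. For an arbitrary labelling let \<open>c\<close> be its most frequent
  label, and let \<open>d\<close> vertices outside the chain deviate from \<open>c\<close>. Class \<open>c\<close> has at least
  \<open>n / (l + 1)\<close> elements, and this yields at least \<open>q + d (n / (l + 1) - l)\<close> crossing edges. Each
  deviation thus costs a factor \<open>r = 2 powr (l - n / (l + 1))\<close>, and summing over all labellings gives
  at most \<open>(l + 1) (1 + l r) ^ (n - l - 1) / 2 ^ q\<close>. As \<open>n r\<close> tends to \<open>0\<close>, the chain event has
  probability asymptotic to \<open>(l + 1) / 2 ^ q\<close>: this is \<open>tendsto_scaled_prob_no_chain_path\<close>.

  With \<open>q = n - 1\<close> for \<open>l = 1\<close> and \<open>q = 2 n - 3\<close> for \<open>l = 2\<close>, the quotient \<open>P A * P B / P (A \<inter> B)\<close>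
  tends to \<open>(2 * 2 / 4 ^ (n - 1)) / (3 / 2 ^ (2 n - 3)) = 2 / 3\<close>.
\<close>

section \<open>Reachability in a random orientation\<close>

lemma finite_complete_edges: "finite (complete_edges n)"
  unfolding complete_edges_def by (rule finite_subset[of _ "Pow {1..n}"]) auto

lemma path_event_iff_rtrancl:
  assumes "u \<in> {1..n}" "w \<in> {1..n}"
  shows "\<omega> \<in> path_event n u w \<longleftrightarrow> (u, w) \<in> (parcs (oriented_graph n \<omega>))\<^sup>*"
proof -
  interpret pair_wf_digraph "oriented_graph n \<omega>"
    by unfold_locales (auto simp: oriented_graph_def complete_edges_def)
  have "\<omega> \<in> path_event n u w \<longleftrightarrow> reachable (with_proj (oriented_graph n \<omega>)) u w"
    unfolding path_event_def reachable_apath by simp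
  also have "\<dots> \<longleftrightarrow> (u, w) \<in> (parcs (oriented_graph n \<omega>))\<^sup>*"
  proof
    assume "reachable (with_proj (oriented_graph n \<omega>)) u w"
    then show "(u, w) \<in> (parcs (oriented_graph n \<omega>))\<^sup>*"
      unfolding reachable_def by (auto dest: rtrancl_on_rtranclI)
  next
    assume *: "(u, w) \<in> (parcs (oriented_graph n \<omega>))\<^sup>*"
    show "reachable (with_proj (oriented_graph n \<omega>)) u w"
      unfolding reachable_def with_proj_simps
      by (rule rtrancl_consistent_rtrancl_on[OF *])
        (use assms in \<open>auto simp: oriented_graph_def complete_edges_def\<close>)
  qed
  finally show ?thesis .
qed

text \<open>
  Outside the support of the distribution the value at an edge may be neither of its endpoints, and
  then the edge carries no arc at all. Arguments that use both directions are therefore restricted to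
  the support.
\<close>

lemma head_in_edge:
  assumes "\<omega> \<in> set_pmf (random_orientation n)" "e \<in> complete_edges n"
  shows "\<omega> e \<in> e"
proof -
  have "finite e" "e \<noteq> {}"
    using assms(2) by (auto simp: complete_edges_def intro: finite_subset)
  then have "set_pmf (pmf_of_set e) = e" by simp
  then show ?thesis
    using assms by (auto simp: random_orientation_def set_Pi_pmf finite_complete_edges PiE_dflt_def)
qed

lemma prob_prescribed_heads:
  assumes F: "F \<subseteq> complete_edges n" and h: "\<And>e. e \<in> F \<Longrightarrow> h e \<in> e"
  shows "measure_pmf.prob (random_orientation n) {\<omega>. \<forall>e\<in>F. \<omega> e = h e} = (1/2) ^ card F"
proof -
  define B where "B e = (if e \<in> F then {h e} else UNIV)" for e
  have half: "measure_pmf.prob (pmf_of_set e) {h e} = 1/2" if "e \<in> F" for e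
  proof -
    have "card e = 2" using F that by (auto simp: complete_edges_def)
    then have "finite e" "e \<noteq> {}" by (auto intro: card_ge_0_finite)
    with \<open>card e = 2\<close> h[OF that] show ?thesis by (simp add: measure_pmf_single)
  qed
  have "{\<omega>. \<forall>e\<in>F. \<omega> e = h e} = Pi (complete_edges n) B"
    using F by (auto simp: B_def Pi_def)
  then have "measure_pmf.prob (random_orientation n) {\<omega>. \<forall>e\<in>F. \<omega> e = h e}
      = (\<Prod>e\<in>complete_edges n. measure_pmf.prob (pmf_of_set e) (B e))"
    unfolding random_orientation_def by (simp add: measure_Pi_pmf_Pi finite_complete_edges)
  also have "\<dots> = (\<Prod>e\<in>F. measure_pmf.prob (pmf_of_set e) (B e))"
    by (rule prod.mono_neutral_right) (use F in \<open>auto simp: finite_complete_edges B_def\<close>)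
  also have "\<dots> = (\<Prod>e\<in>F. 1/2)"
    by (rule prod.cong) (auto simp: half B_def)
  finally show ?thesis by simp
qed

text \<open>
  Each unordered pair of events is subtracted twice here; this weaker form of the Bonferroni inequality
  avoids ordering the index set.
\<close>

lemma prob_UN_ge_Bonferroni:
  fixes E :: "'i \<Rightarrow> 'a set" and p :: "'a pmf"
  assumes "finite I"
  shows "(\<Sum>i\<in>I. measure_pmf.prob p (E i))
      - (\<Sum>i\<in>I. \<Sum>j\<in>I - {i}. measure_pmf.prob p (E i \<inter> E j))
    \<le> measure_pmf.prob p (\<Union>i\<in>I. E i)"
  using assms
proof induction
  case (insert k I)
  let ?P = "measure_pmf.prob p"
  let ?U = "\<Union>i\<in>I. E i"
  have "?P (E k \<inter> ?U) \<le> (\<Sum>j\<in>I. ?P (E k \<inter> E j))"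
    unfolding Int_UN_distrib by (rule measure_UNION_le) (use insert in auto)
  moreover have "?P (E k \<union> ?U) = ?P (E k) + ?P ?U - ?P (E k \<inter> ?U)"
    by (rule measure_Un3) (simp_all add: measure_pmf.fmeasurable_eq_sets)
  moreover have "(\<Sum>i\<in>I. \<Sum>j\<in>I - {i}. ?P (E i \<inter> E j)) + (\<Sum>j\<in>I. ?P (E k \<inter> E j))
      \<le> (\<Sum>i\<in>insert k I. \<Sum>j\<in>insert k I - {i}. ?P (E i \<inter> E j))"
  proof -
    have "(\<Sum>i\<in>I. \<Sum>j\<in>I - {i}. ?P (E i \<inter> E j)) \<le> (\<Sum>i\<in>I. \<Sum>j\<in>insert k I - {i}. ?P (E i \<inter> E j))"
      using insert by (intro sum_mono sum_mono2) auto
    moreover have "insert k I - {k} = I" using insert by auto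
    ultimately show ?thesis using insert by simp
  qed
  ultimately show ?case using insert by simp
qed simp

section \<open>Orientations along which a labelling descends\<close>

text \<open>
  An edge has two elements, so injectivity on it says that its endpoints have distinct labels.
\<close>

definition crossing_edges :: "nat \<Rightarrow> (nat \<Rightarrow> nat) \<Rightarrow> nat set set" where
  "crossing_edges n x = {e \<in> complete_edges n. inj_on x e}"

definition descending_event :: "nat \<Rightarrow> (nat \<Rightarrow> nat) \<Rightarrow> (nat set \<Rightarrow> nat) set" where
  "descending_event n x = {\<omega>. \<forall>e\<in>crossing_edges n x. \<omega> e = arg_min_on x e}"

lemma crossing_edges_subset: "crossing_edges n x \<subseteq> complete_edges n"
  by (auto simp: crossing_edges_def)

lemma finite_crossing_edges: "finite (crossing_edges n x)"
  by (rule finite_subset[OF crossing_edges_subset finite_complete_edges])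

lemma arg_min_on_edge:
  fixes x :: "nat \<Rightarrow> nat"
  assumes "e \<in> complete_edges n"
  shows "arg_min_on x e \<in> e"
proof -
  have "card e = 2" using assms by (auto simp: complete_edges_def)
  then have "finite e" "e \<noteq> {}" by (auto intro: card_ge_0_finite)
  then show ?thesis by (rule arg_min_if_finite(1))
qed

lemma arg_min_on_pair:
  fixes x :: "nat \<Rightarrow> nat"
  assumes "x u < x w"
  shows "arg_min_on x {u, w} = u"
proof -
  have "arg_min_on x {u, w} \<in> {u, w}" "\<not> (\<exists>y\<in>{u, w}. x y < x (arg_min_on x {u, w}))"
    using arg_min_if_finite[of "{u, w}" x] by auto
  with assms show ?thesis by auto
qed

lemma prob_descending_event:
  "measure_pmf.prob (random_orientation n) (descending_event n x) = (1/2) ^ card (crossing_edges n x)"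
  unfolding descending_event_def
  by (rule prob_prescribed_heads[OF crossing_edges_subset])
    (use arg_min_on_edge crossing_edges_subset in blast)

text \<open>
  The two labellings may ask for opposite directions of an edge, in which case the events are disjoint.
  Otherwise all edges crossed by one of them are prescribed. An upper bound covers both cases.
\<close>

lemma prob_two_descending_events_le:
  "measure_pmf.prob (random_orientation n) (descending_event n x \<inter> descending_event n y)
    \<le> (1/2) ^ card (crossing_edges n x \<union> crossing_edges n y)"
proof -
  let ?h = "\<lambda>e. if e \<in> crossing_edges n x then arg_min_on x e else arg_min_on y e"
  have "measure_pmf.prob (random_orientation n) (descending_event n x \<inter> descending_event n y)
      \<le> measure_pmf.prob (random_orientation n)
          {\<omega>. \<forall>e\<in>crossing_edges n x \<union> crossing_edges n y. \<omega> e = ?h e}"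
    by (rule measure_pmf.finite_measure_mono) (auto simp: descending_event_def)
  also have "\<dots> = (1/2) ^ card (crossing_edges n x \<union> crossing_edges n y)"
    by (rule prob_prescribed_heads)
      (use arg_min_on_edge crossing_edges_subset in \<open>auto dest!: subsetD[OF crossing_edges_subset]\<close>)
  finally show ?thesis .
qed

lemma pair_in_crossing_edges:
  assumes "u \<in> {1..n}" "w \<in> {1..n}" "x u \<noteq> x w"
  shows "{u, w} \<in> crossing_edges n x"
  using assms by (auto simp: crossing_edges_def complete_edges_def card_insert_if)

lemma crossing_edgesE:
  assumes "e \<in> crossing_edges n x"
  obtains u w where "e = {u, w}" "u \<in> {1..n}" "w \<in> {1..n}" "x u < x w"
proof -
  from assms have "card e = 2" "e \<subseteq> {1..n}" "inj_on x e"
    by (auto simp: crossing_edges_def complete_edges_def)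
  then obtain u w where uw: "e = {u, w}" "u \<noteq> w" by (auto simp: card_2_iff)
  with \<open>inj_on x e\<close> have "x u < x w \<or> x w < x u" by (auto simp: inj_on_def)
  then show ?thesis
    using that[of u w] that[of w u] uw \<open>e \<subseteq> {1..n}\<close> by (auto simp: insert_commute)
qed

lemma descending_event_iff:
  assumes "\<omega> \<in> set_pmf (random_orientation n)"
  shows "\<omega> \<in> descending_event n x \<longleftrightarrow> (\<forall>(u, w)\<in>parcs (oriented_graph n \<omega>). x w \<le> x u)"
proof
  assume desc: "\<omega> \<in> descending_event n x"
  show "\<forall>(u, w)\<in>parcs (oriented_graph n \<omega>). x w \<le> x u"
  proof (rule ccontr)
    assume "\<not> ?thesis"
    then obtain u w where uw: "(u, w) \<in> parcs (oriented_graph n \<omega>)" "x u < x w" by auto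
    then have "{u, w} \<in> complete_edges n" "\<omega> {u, w} = w" by (auto simp: oriented_graph_def)
    moreover have "{u, w} \<in> crossing_edges n x"
      using uw calculation by (intro pair_in_crossing_edges) (auto simp: complete_edges_def)
    ultimately have "w = u"
      using desc arg_min_on_pair[of x u w] uw(2) by (auto simp: descending_event_def)
    with uw show False by simp
  qed
next
  assume desc: "\<forall>(u, w)\<in>parcs (oriented_graph n \<omega>). x w \<le> x u"
  show "\<omega> \<in> descending_event n x"
    unfolding descending_event_def
  proof (intro CollectI ballI)
    fix e assume e: "e \<in> crossing_edges n x"
    then obtain u w where uw: "e = {u, w}" "x u < x w" by (rule crossing_edgesE)
    have "e \<in> complete_edges n" using e crossing_edges_subset by auto
    moreover have "\<omega> e \<noteq> w"
      using desc uw \<open>e \<in> complete_edges n\<close> by (fastforce simp: oriented_graph_def)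
    ultimately have "\<omega> e = u" using head_in_edge[OF assms] uw by blast
    with uw show "\<omega> e = arg_min_on x e" by (simp add: arg_min_on_pair)
  qed
qed

section \<open>Chains of vertices with every step blocked\<close>

locale vertex_chain =
  fixes n l :: nat and v :: "nat \<Rightarrow> nat"
  assumes chain_vertices: "\<And>i. i \<le> l \<Longrightarrow> v i \<in> {1..n}"
    and chain_inj: "inj_on v {..l}"
begin

definition free_vertices :: "nat set" where
  "free_vertices = {1..n} - v ` {..l}"

definition chain_labelling :: "(nat \<Rightarrow> nat) \<Rightarrow> nat \<Rightarrow> nat" where
  "chain_labelling x u = (if u \<in> v ` {..l} then inv_into {..l} v u else x u)"

definition no_chain_path :: "(nat set \<Rightarrow> nat) set" where
  "no_chain_path = (\<Inter>i<l. no_path_event n (v i) (v (Suc i)))"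

lemma finite_free_vertices [simp]: "finite free_vertices"
  by (simp add: free_vertices_def)

lemma card_free_vertices: "card free_vertices = n - Suc l"
proof -
  have sub: "v ` {..l} \<subseteq> {1..n}" using chain_vertices by auto
  have c: "card (v ` {..l}) = Suc l" using chain_inj by (simp add: card_image)
  show ?thesis
    unfolding free_vertices_def using sub c by (subst card_Diff_subset) auto
qed

lemma chain_labelling_chain [simp]: "i \<le> l \<Longrightarrow> chain_labelling x (v i) = i"
  by (auto simp: chain_labelling_def chain_inj)

lemma chain_labelling_free [simp]: "u \<in> free_vertices \<Longrightarrow> chain_labelling x u = x u"
  by (auto simp: chain_labelling_def free_vertices_def)

lemma vertex_cases:
  assumes "u \<in> {1..n}"
  obtains i where "i \<le> l" "u = v i" | "u \<in> free_vertices"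
  using assms by (auto simp: free_vertices_def)

text \<open>
  A blocked chain comes with a descending labelling, namely the index of the first chain vertex that
  reaches a given vertex. Prolonging a path by an arc can only decrease this index. That \<open>v i\<close> itself
  gets label \<open>i\<close> uses completeness of the graph: the chain edges exist and point backwards, so a path
  from \<open>v j\<close> to \<open>v i\<close> with \<open>j < i\<close> could be continued back to \<open>v (Suc j)\<close>.
\<close>

lemma no_chain_path_imp_descending:
  assumes \<omega>: "\<omega> \<in> set_pmf (random_orientation n)" and no: "\<omega> \<in> no_chain_path"
  obtains x where "x \<in> free_vertices \<rightarrow>\<^sub>E {..l}" "\<omega> \<in> descending_event n (chain_labelling x)"
proof -
  define R where "R = parcs (oriented_graph n \<omega>)"
  have no': "(v i, v (Suc i)) \<notin> R\<^sup>*" if "i < l" for i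
  proof -
    have "\<omega> \<notin> path_event n (v i) (v (Suc i))"
      using no that by (auto simp: no_chain_path_def no_path_event_def)
    then show ?thesis
      using that chain_vertices[of i] chain_vertices[of "Suc i"]
      by (simp add: path_event_iff_rtrancl R_def)
  qed
  have back_arc: "(v (Suc i), v i) \<in> R" if "i < l" for i
  proof -
    have "v i \<noteq> v (Suc i)" using inj_onD[OF chain_inj, of i "Suc i"] that by auto
    then have e: "{v i, v (Suc i)} \<in> complete_edges n"
      using chain_vertices[of i] chain_vertices[of "Suc i"] that by (auto simp: complete_edges_def)
    have "\<omega> {v i, v (Suc i)} \<noteq> v (Suc i)"
      using no'[OF that] e by (auto simp: R_def oriented_graph_def)
    then have "\<omega> {v i, v (Suc i)} = v i" using head_in_edge[OF \<omega> e] by auto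
    with e show ?thesis by (simp add: R_def oriented_graph_def insert_commute)
  qed
  have back_path: "(v i, v j) \<in> R\<^sup>*" if "j \<le> i" "i \<le> l" for i j
    using that
  proof (induction rule: dec_induct)
    case (step k)
    then show ?case using back_arc[of k] by (auto intro: converse_rtrancl_into_rtrancl)
  qed simp
  define x where "x u = (LEAST i. i = l \<or> (v i, u) \<in> R\<^sup>*)" for u
  have x_le: "x u \<le> l" for u unfolding x_def by (rule Least_le) simp
  have x_chain: "x (v i) = i" if "i \<le> l" for i
    unfolding x_def
  proof (rule Least_equality)
    show "i = l \<or> (v i, v i) \<in> R\<^sup>*" by simp
    fix j assume j: "j = l \<or> (v j, v i) \<in> R\<^sup>*"
    show "i \<le> j"
    proof (rule ccontr)
      assume "\<not> i \<le> j"
      then have "j < i" by simp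
      with j that have "(v j, v i) \<in> R\<^sup>*" by auto
      also have "(v i, v (Suc j)) \<in> R\<^sup>*" using back_path \<open>j < i\<close> that by simp
      finally show False using no'[of j] \<open>j < i\<close> that by simp
    qed
  qed
  have x_mono: "x w \<le> x u" if "(u, w) \<in> R" for u w
  proof -
    have "x u = l \<or> (v (x u), u) \<in> R\<^sup>*"
      unfolding x_def by (rule LeastI[of _ l]) simp
    then have "x u = l \<or> (v (x u), w) \<in> R\<^sup>*"
      using that by (blast intro: rtrancl_into_rtrancl)
    then show ?thesis unfolding x_def[of w] by (rule Least_le)
  qed
  define y where "y = restrict x free_vertices"
  have lab: "chain_labelling y u = x u" if "u \<in> {1..n}" for u
    using that by (cases rule: vertex_cases) (auto simp: x_chain y_def)
  show thesis
  proof (rule that)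
    show "y \<in> free_vertices \<rightarrow>\<^sub>E {..l}" using x_le by (auto simp: y_def)
    have "u \<in> {1..n}" "w \<in> {1..n}" if "(u, w) \<in> R" for u w
      using that by (auto simp: R_def oriented_graph_def complete_edges_def)
    then show "\<omega> \<in> descending_event n (chain_labelling y)"
      unfolding descending_event_iff[OF \<omega>] using x_mono by (auto simp: lab R_def)
  qed
qed

lemma descending_imp_no_chain_path:
  assumes \<omega>: "\<omega> \<in> set_pmf (random_orientation n)"
    and desc: "\<omega> \<in> descending_event n (chain_labelling x)"
  shows "\<omega> \<in> no_chain_path"
proof -
  have le: "chain_labelling x w \<le> chain_labelling x u"
    if "(u, w) \<in> (parcs (oriented_graph n \<omega>))\<^sup>*" for u w
    using that
  proof induction
    case (step y z)
    then show ?case using desc descending_event_iff[OF \<omega>] by fastforce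
  qed simp
  show ?thesis
    unfolding no_chain_path_def no_path_event_def
  proof (intro INT_I ComplI)
    fix i assume "i \<in> {..<l}" "\<omega> \<in> path_event n (v i) (v (Suc i))"
    then show False
      using le[of "v i" "v (Suc i)"] chain_vertices[of i] chain_vertices[of "Suc i"]
      by (simp add: path_event_iff_rtrancl)
  qed
qed

section \<open>Counting the edges crossed by a labelling\<close>

definition label_class :: "(nat \<Rightarrow> nat) \<Rightarrow> nat \<Rightarrow> nat set" where
  "label_class x c = {u \<in> {1..n}. chain_labelling x u = c}"

definition deviations :: "(nat \<Rightarrow> nat) \<Rightarrow> nat \<Rightarrow> nat" where
  "deviations x c = card {u \<in> free_vertices. x u \<noteq> c}"

text \<open>
  The number of edges crossed when all vertices outside the chain have the same label, as
  \<open>card_crossing_edges_const\<close> shows.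
\<close>

definition constant_crossings :: nat where
  "constant_crossings = (l choose 2) + l * (n - l)"

lemma card_outside_label_class:
  assumes "c \<le> l"
  shows "card ({1..n} - label_class x c) = l + deviations x c"
proof -
  have "{1..n} - label_class x c = v ` ({..l} - {c}) \<union> {u \<in> free_vertices. x u \<noteq> c}"
  proof (rule set_eqI)
    fix u
    show "u \<in> {1..n} - label_class x c \<longleftrightarrow> u \<in> v ` ({..l} - {c}) \<union> {u \<in> free_vertices. x u \<noteq> c}"
    proof (cases "u \<in> {1..n}")
      case True
      then show ?thesis
      proof (cases rule: vertex_cases)
        case (1 i)
        have "v i \<in> v ` ({..l} - {c}) \<longleftrightarrow> i \<noteq> c"
          using 1(1) assms inj_onD[OF chain_inj] by fastforce
        moreover have "v i \<notin> free_vertices" using 1(1) by (auto simp: free_vertices_def)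
        ultimately show ?thesis using 1 True by (auto simp: label_class_def)
      next
        case 2
        then show ?thesis using True by (auto simp: label_class_def free_vertices_def)
      qed
    next
      case False
      then show ?thesis using chain_vertices by (auto simp: free_vertices_def)
    qed
  qed
  moreover have "v ` ({..l} - {c}) \<inter> {u \<in> free_vertices. x u \<noteq> c} = {}"
    by (auto simp: free_vertices_def)
  moreover have "card (v ` ({..l} - {c})) = l"
    using assms by (subst card_image) (auto intro: inj_on_subset[OF chain_inj])
  ultimately show ?thesis by (simp add: card_Un_disjoint deviations_def)
qed

lemma card_label_class:
  assumes "c \<le> l"
  shows "card (label_class x c) + (l + deviations x c) = n"
proof -
  have "card (label_class x c) + card ({1..n} - label_class x c) = card {1..n}"
  proof -
    have "label_class x c \<subseteq> {1..n}" by (auto simp: label_class_def)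
    then show ?thesis by (subst card_Un_disjoint[symmetric]) (auto dest: finite_subset simp: Un_absorb1)
  qed
  then show ?thesis using card_outside_label_class[OF assms] by simp
qed

text \<open>
  Two families of edges are crossed for certain: those between two chain vertices whose labels differ
  from \<open>c\<close>, and those between the class of \<open>c\<close> and its complement. They are disjoint since the first
  family avoids the class of \<open>c\<close>. If no vertex deviates from \<open>c\<close>, no other edge is crossed.
\<close>

lemma card_guaranteed_crossings:
  fixes x :: "nat \<Rightarrow> nat"
  assumes "c \<le> l"
  defines "K \<equiv> {e. e \<subseteq> v ` ({..l} - {c}) \<and> card e = 2}"
    and "M \<equiv> (\<lambda>(u, w). {u, w}) ` (label_class x c \<times> ({1..n} - label_class x c))"
  shows "card (K \<union> M) = (l choose 2) + card (label_class x c) * (l + deviations x c)"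
proof -
  have "card K = card (v ` ({..l} - {c})) choose 2"
    unfolding K_def by (rule n_subsets) simp
  moreover have "card (v ` ({..l} - {c})) = l"
    using assms by (subst card_image) (auto intro: inj_on_subset[OF chain_inj])
  ultimately have cK: "card K = l choose 2" by simp
  have "inj_on (\<lambda>(u, w). {u, w}) (label_class x c \<times> ({1..n} - label_class x c))"
    by (auto simp: inj_on_def doubleton_eq_iff)
  then have cM: "card M = card (label_class x c) * (l + deviations x c)"
    unfolding M_def
    by (simp add: card_image card_cartesian_product card_outside_label_class[OF assms(1)] del: One_nat_def)
  have "K \<inter> M = {}"
  proof -
    have "e \<inter> label_class x c = {}" if "e \<in> K" for e
      using that by (auto simp: K_def label_class_def)
    moreover have "e \<inter> label_class x c \<noteq> {}" if "e \<in> M" for e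
      using that by (auto simp: M_def)
    ultimately show ?thesis by blast
  qed
  moreover have "finite K"
    unfolding K_def by (rule finite_subset[of _ "Pow (v ` ({..l} - {c}))"]) auto
  moreover have "finite M" unfolding M_def by (auto simp: label_class_def)
  ultimately show ?thesis by (simp add: card_Un_disjoint cK cM)
qed

lemma card_crossing_edges_ge:
  assumes "c \<le> l"
  shows "(l choose 2) + card (label_class x c) * (l + deviations x c)
    \<le> card (crossing_edges n (chain_labelling x))"
  unfolding card_guaranteed_crossings[OF assms, symmetric]
proof (rule card_mono[OF finite_crossing_edges], rule Un_least)
  show "{e. e \<subseteq> v ` ({..l} - {c}) \<and> card e = 2} \<subseteq> crossing_edges n (chain_labelling x)"
  proof clarify
    fix e assume e: "e \<subseteq> v ` ({..l} - {c})" "card e = 2"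
    then obtain u w where uw: "e = {u, w}" "u \<noteq> w" by (auto simp: card_2_iff)
    then obtain i j where "i \<le> l" "j \<le> l" "u = v i" "w = v j" using e by auto
    then show "e \<in> crossing_edges n (chain_labelling x)"
      using uw chain_vertices by (auto intro!: pair_in_crossing_edges)
  qed
  show "(\<lambda>(u, w). {u, w}) ` (label_class x c \<times> ({1..n} - label_class x c))
      \<subseteq> crossing_edges n (chain_labelling x)"
    by (auto simp: label_class_def intro!: pair_in_crossing_edges)
qed

lemma card_crossing_edges_const:
  assumes "c \<le> l"
  shows "card (crossing_edges n (chain_labelling (\<lambda>_. c))) = constant_crossings"
proof -
  let ?x = "\<lambda>_::nat. c"
  have dev: "deviations ?x c = 0" by (simp add: deviations_def)
  then have cls: "card (label_class ?x c) = n - l" using card_label_class[OF assms, of ?x] by simp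
  have "crossing_edges n (chain_labelling ?x) \<subseteq> {e. e \<subseteq> v ` ({..l} - {c}) \<and> card e = 2}
      \<union> (\<lambda>(u, w). {u, w}) ` (label_class ?x c \<times> ({1..n} - label_class ?x c))"
  proof
    fix e assume "e \<in> crossing_edges n (chain_labelling ?x)"
    then obtain u w where uw: "e = {u, w}" "u \<in> {1..n}" "w \<in> {1..n}"
        "chain_labelling ?x u < chain_labelling ?x w" by (rule crossing_edgesE)
    have out: "z \<in> v ` ({..l} - {c})" if "z \<in> {1..n}" "chain_labelling ?x z \<noteq> c" for z
      using that by (cases rule: vertex_cases) auto
    have "u \<noteq> w" using uw(4) by auto
    consider "chain_labelling ?x u = c" | "chain_labelling ?x w = c"
      | "chain_labelling ?x u \<noteq> c" "chain_labelling ?x w \<noteq> c" by blast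
    then show "e \<in> {e. e \<subseteq> v ` ({..l} - {c}) \<and> card e = 2}
      \<union> (\<lambda>(u, w). {u, w}) ` (label_class ?x c \<times> ({1..n} - label_class ?x c))"
    proof cases
      case 1
      then have "(u, w) \<in> label_class ?x c \<times> ({1..n} - label_class ?x c)"
        using uw by (auto simp: label_class_def)
      then show ?thesis using uw(1) by blast
    next
      case 2
      then have "(w, u) \<in> label_class ?x c \<times> ({1..n} - label_class ?x c)"
        using uw by (auto simp: label_class_def)
      moreover have "e = (\<lambda>(u, w). {u, w}) (w, u)" using uw(1) by auto
      ultimately show ?thesis by blast
    next
      case 3
      then show ?thesis using out[of u] out[of w] uw \<open>u \<noteq> w\<close> by auto
    qed
  qed
  then have "card (crossing_edges n (chain_labelling ?x)) \<le> (l choose 2) + card (label_class ?x c) * (l + deviations ?x c)"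
    unfolding card_guaranteed_crossings[OF assms, symmetric]
    by (rule card_mono[rotated]) (auto simp: label_class_def intro: finite_subset[of _ "Pow (v ` ({..l} - {c}))"])
  with card_crossing_edges_ge[OF assms, of ?x] show ?thesis
    by (simp add: dev cls constant_crossings_def)
qed

lemma exists_large_label_class:
  assumes "x \<in> free_vertices \<rightarrow>\<^sub>E {..l}"
  obtains c where "c \<le> l" "n \<le> Suc l * card (label_class x c)"
proof (rule ccontr)
  assume "\<not> thesis"
  then have small: "Suc l * card (label_class x c) < n" if "c \<le> l" for c
    using that \<open>\<And>c. c \<le> l \<Longrightarrow> n \<le> Suc l * card (label_class x c) \<Longrightarrow> thesis\<close> by force
  have "chain_labelling x u \<le> l" if "u \<in> {1..n}" for u
    using that assms by (cases rule: vertex_cases) (auto dest: PiE_mem)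
  then have "(\<Sum>c\<le>l. card (label_class x c)) = card {1..n}"
    unfolding label_class_def card_eq_sum by (intro sum.group) auto
  then have "(\<Sum>c\<le>l. Suc l * card (label_class x c)) = Suc l * n"
    by (simp only: sum_distrib_left[symmetric] card_atLeastAtMost diff_Suc_1 add_diff_cancel)
  moreover have "(\<Sum>c\<le>l. Suc l * card (label_class x c)) < (\<Sum>c\<le>l. n)"
    by (rule sum_strict_mono) (use small in auto)
  ultimately show False by simp
qed

section \<open>Bounds on the probability that every step of a chain is blocked\<close>

abbreviation P :: "(nat set \<Rightarrow> nat) set \<Rightarrow> real" where
  "P \<equiv> measure_pmf.prob (random_orientation n)"

text \<open>
  The factor that one deviation from the most frequent label costs in probability, relative to a
  constant labelling.
\<close>

definition deviation_weight :: real where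
  "deviation_weight = 2 powr (real l - real n / real (Suc l))"

text \<open>
  Let \<open>c\<close> be a most frequent label, \<open>m\<close> the size of its class and \<open>d\<close> the number of deviations, so
  that \<open>n = m + l + d\<close>. The count of crossing edges exceeds that of a constant labelling by at least
  \<open>m (l + d) - l (m + d) = d (m - l)\<close>, and \<open>m\<close> is at least \<open>n / (l + 1)\<close>. Summing over all \<open>c\<close> in the
  bound makes it independent of the choice of \<open>c\<close>.
\<close>

lemma prob_descending_labelling_le:
  assumes "x \<in> free_vertices \<rightarrow>\<^sub>E {..l}"
  shows "2 ^ constant_crossings * P (descending_event n (chain_labelling x))
    \<le> (\<Sum>c\<le>l. deviation_weight ^ deviations x c)"
proof -
  obtain c where c: "c \<le> l" "n \<le> Suc l * card (label_class x c)"
    using exists_large_label_class[OF assms] .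
  define m where "m = card (label_class x c)"
  define d where "d = deviations x c"
  define q where "q = card (crossing_edges n (chain_labelling x))"
  have n: "n = m + l + d" using card_label_class[OF c(1), of x] by (simp add: m_def d_def)
  have q: "(l choose 2) + m * (l + d) \<le> q"
    using card_crossing_edges_ge[OF c(1), of x] by (simp add: m_def d_def q_def)
  have "real n \<le> real (Suc l) * real m"
    using c(2) unfolding m_def of_nat_mult[symmetric] of_nat_le_iff .
  then have "real n / real (Suc l) \<le> real m" by (simp add: field_simps)
  then have m: "real d * (real l - real m) \<le> real d * (real l - real n / real (Suc l))"
    by (intro mult_left_mono) auto
  have "real constant_crossings = real (l choose 2) + real l * (real m + real d)"
    unfolding constant_crossings_def using n by (simp add: add.commute)
  moreover have "real (l choose 2) + real m * (real l + real d) \<le> real q"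
    using q by (metis of_nat_add of_nat_le_iff of_nat_mult)
  ultimately have "real constant_crossings - real q \<le> real d * (real l - real n / real (Suc l))"
    using m by (simp add: algebra_simps)
  then have "2 powr (real constant_crossings - real q) \<le> 2 powr (real d * (real l - real n / real (Suc l)))"
    by simp
  moreover have "2 powr (real constant_crossings - real q) = 2 ^ constant_crossings * (1/2) ^ q"
    by (simp add: powr_diff powr_realpow power_one_over)
  moreover have "2 powr (real d * (real l - real n / real (Suc l))) = deviation_weight ^ d"
    unfolding deviation_weight_def by (subst powr_realpow[symmetric]) (simp_all add: powr_powr mult.commute)
  ultimately have "2 ^ constant_crossings * P (descending_event n (chain_labelling x)) \<le> deviation_weight ^ d"
    by (simp only: prob_descending_event q_def)
  also have "\<dots> \<le> (\<Sum>c\<le>l. deviation_weight ^ deviations x c)"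
    unfolding d_def
    by (rule member_le_sum) (use c in \<open>auto simp: deviation_weight_def\<close>)
  finally show ?thesis .
qed

text \<open>
  Vertices outside the chain are labelled independently, so the sum factorizes: each contributes \<open>1\<close>
  for the label \<open>c\<close> and the deviation weight for each of the \<open>l\<close> other labels.
\<close>

lemma sum_deviation_weight:
  assumes "c \<le> l"
  shows "(\<Sum>x\<in>free_vertices \<rightarrow>\<^sub>E {..l}. deviation_weight ^ deviations x c)
    = (1 + real l * deviation_weight) ^ (n - Suc l)"
proof -
  have "deviation_weight ^ deviations x c
      = (\<Prod>u\<in>free_vertices. if x u = c then 1 else deviation_weight)" for x
    by (simp add: deviations_def prod.If_cases Int_def)
  then have "(\<Sum>x\<in>free_vertices \<rightarrow>\<^sub>E {..l}. deviation_weight ^ deviations x c)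
      = (\<Prod>u\<in>free_vertices. \<Sum>j\<le>l. if j = c then 1 else deviation_weight)"
    by (subst prod_sum_PiE) auto
  also have "(\<Sum>j\<le>l. if j = c then 1 else deviation_weight) = 1 + real l * deviation_weight"
    using assms by (subst sum.remove[of _ c]) auto
  finally show ?thesis by (simp add: card_free_vertices)
qed

lemma prob_no_chain_path_le:
  "2 ^ constant_crossings * P no_chain_path \<le> real (Suc l) * (1 + real l * deviation_weight) ^ (n - Suc l)"
proof -
  let ?X = "free_vertices \<rightarrow>\<^sub>E {..l}"
  have "P no_chain_path = P (no_chain_path \<inter> set_pmf (random_orientation n))"
    by (simp add: measure_Int_set_pmf)
  also have "\<dots> \<le> P (\<Union>x\<in>?X. descending_event n (chain_labelling x))"
    by (rule measure_pmf.finite_measure_mono) (auto elim!: no_chain_path_imp_descending)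
  also have "\<dots> \<le> (\<Sum>x\<in>?X. P (descending_event n (chain_labelling x)))"
    by (rule measure_UNION_le) (auto intro: finite_PiE)
  finally have "2 ^ constant_crossings * P no_chain_path
      \<le> (\<Sum>x\<in>?X. 2 ^ constant_crossings * P (descending_event n (chain_labelling x)))"
    by (simp flip: sum_distrib_left)
  also have "\<dots> \<le> (\<Sum>x\<in>?X. \<Sum>c\<le>l. deviation_weight ^ deviations x c)"
    by (intro sum_mono prob_descending_labelling_le)
  also have "\<dots> = (\<Sum>c\<le>l. \<Sum>x\<in>?X. deviation_weight ^ deviations x c)"
    by (rule sum.swap)
  also have "\<dots> = (\<Sum>c\<le>l. (1 + real l * deviation_weight) ^ (n - Suc l))"
    by (intro sum.cong) (auto simp: sum_deviation_weight)
  finally show ?thesis by simp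
qed

text \<open>
  The edges from \<open>v c\<close> to the vertices outside the chain are crossed when the latter have label \<open>c'\<close>,
  but not when they have label \<open>c\<close>. Hence the second event prescribes \<open>n - Suc l\<close> edges in addition to
  those of the first.
\<close>

lemma prob_two_constant_labellings_le:
  assumes "c \<le> l" "c' \<le> l" "c \<noteq> c'"
  shows "P (descending_event n (chain_labelling (\<lambda>_. c)) \<inter> descending_event n (chain_labelling (\<lambda>_. c')))
    \<le> (1/2) ^ (constant_crossings + (n - Suc l))"
proof -
  let ?y = "chain_labelling (\<lambda>_. c)" and ?y' = "chain_labelling (\<lambda>_. c')"
  let ?star = "(\<lambda>u. {v c, u}) ` free_vertices"
  have "v c \<notin> free_vertices" using assms by (auto simp: free_vertices_def)
  then have "card ?star = n - Suc l"
    unfolding card_free_vertices[symmetric]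
    by (intro card_image) (auto simp: inj_on_def doubleton_eq_iff)
  have star': "?star \<subseteq> crossing_edges n ?y'"
  proof clarify
    fix u assume u: "u \<in> free_vertices"
    then have "u \<in> {1..n}" by (simp add: free_vertices_def)
    with u show "{v c, u} \<in> crossing_edges n ?y'"
      using assms chain_vertices[of c] by (intro pair_in_crossing_edges) auto
  qed
  have star: "?star \<inter> crossing_edges n ?y = {}"
  proof -
    have "\<not> inj_on ?y {v c, u}" if "u \<in> free_vertices" for u
    proof -
      have "v c \<noteq> u" using that \<open>v c \<notin> free_vertices\<close> by auto
      moreover have "?y (v c) = ?y u" using that assms(1) by simp
      ultimately show ?thesis by (simp add: inj_on_def)
    qed
    then show ?thesis unfolding crossing_edges_def by blast
  qed
  have "constant_crossings + (n - Suc l) = card (crossing_edges n ?y \<union> ?star)"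
    using star \<open>card ?star = n - Suc l\<close> card_crossing_edges_const[OF assms(1)]
    by (subst card_Un_disjoint) (auto simp: finite_crossing_edges)
  also have "\<dots> \<le> card (crossing_edges n ?y \<union> crossing_edges n ?y')"
    using star' by (intro card_mono) (auto simp: finite_crossing_edges)
  finally have "(1/2::real) ^ card (crossing_edges n ?y \<union> crossing_edges n ?y')
      \<le> (1/2) ^ (constant_crossings + (n - Suc l))"
    by (intro power_decreasing) auto
  with prob_two_descending_events_le[of n ?y ?y'] show ?thesis by linarith
qed

lemma prob_no_chain_path_ge:
  "real (Suc l) - real (Suc l) * real l * (1/2) ^ (n - Suc l) \<le> 2 ^ constant_crossings * P no_chain_path"
proof -
  let ?E = "\<lambda>c. descending_event n (chain_labelling (\<lambda>_. c))"
  have "real (Suc l) * (1/2) ^ constant_crossings - real (Suc l) * real l * (1/2) ^ (constant_crossings + (n - Suc l))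
      = (\<Sum>c\<le>l. P (?E c)) - (\<Sum>c\<le>l. \<Sum>c'\<in>{..l} - {c}. (1/2) ^ (constant_crossings + (n - Suc l)))"
    by (simp add: prob_descending_event card_crossing_edges_const)
  also have "\<dots> \<le> (\<Sum>c\<le>l. P (?E c)) - (\<Sum>c\<le>l. \<Sum>c'\<in>{..l} - {c}. P (?E c \<inter> ?E c'))"
    by (intro diff_left_mono sum_mono prob_two_constant_labellings_le) auto
  also have "\<dots> \<le> P (\<Union>c\<le>l. ?E c)"
    by (rule prob_UN_ge_Bonferroni) simp
  also have "\<dots> = P ((\<Union>c\<le>l. ?E c) \<inter> set_pmf (random_orientation n))"
    by (simp only: measure_Int_set_pmf)
  also have "\<dots> \<le> P no_chain_path"
    by (rule measure_pmf.finite_measure_mono) (auto intro: descending_imp_no_chain_path)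
  finally have "2 ^ constant_crossings * (real (Suc l) * (1/2) ^ constant_crossings
      - real (Suc l) * real l * (1/2) ^ (constant_crossings + (n - Suc l))) \<le> 2 ^ constant_crossings * P no_chain_path"
    by (intro mult_left_mono) auto
  moreover have "2 ^ constant_crossings * (real (Suc l) * (1/2) ^ constant_crossings
      - real (Suc l) * real l * (1/2) ^ (constant_crossings + (n - Suc l)))
      = real (Suc l) - real (Suc l) * real l * (1/2) ^ (n - Suc l)"
    by (simp add: power_add right_diff_distrib power_one_over)
  ultimately show ?thesis by (simp only:)
qed

end

section \<open>Asymptotics\<close>

lemma tendsto_scaled_prob_no_chain_path:
  fixes l :: nat and v :: "nat \<Rightarrow> nat \<Rightarrow> nat"
  assumes chain: "\<forall>\<^sub>F n in sequentially. vertex_chain n l (v n)"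
  shows "(\<lambda>n. 2 ^ ((l choose 2) + l * (n - l))
      * measure_pmf.prob (random_orientation n) (vertex_chain.no_chain_path n l (v n)))
    \<longlonglongrightarrow> real (Suc l)"
proof (rule tendsto_sandwich)
  \<comment> \<open>the deviation weight as a function of \<open>n\<close>\<close>
  define r where "r n = 2 powr (real l - real n / real (Suc l))" for n
  show "\<forall>\<^sub>F n in sequentially. real (Suc l) - real (Suc l) * real l * (1/2) ^ (n - Suc l)
    \<le> 2 ^ ((l choose 2) + l * (n - l))
      * measure_pmf.prob (random_orientation n) (vertex_chain.no_chain_path n l (v n))"
    using chain
  proof eventually_elim
    case (elim n)
    then interpret vertex_chain n l "v n" .
    show ?case using prob_no_chain_path_ge by (simp add: constant_crossings_def)
  qed
  show "\<forall>\<^sub>F n in sequentially. 2 ^ ((l choose 2) + l * (n - l))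
      * measure_pmf.prob (random_orientation n) (vertex_chain.no_chain_path n l (v n))
    \<le> real (Suc l) * exp (real l * (real n * r n))"
    using chain
  proof eventually_elim
    case (elim n)
    then interpret vertex_chain n l "v n" .
    have "(1 + real l * r n) ^ (n - Suc l) \<le> exp (real l * r n) ^ (n - Suc l)"
      by (intro power_mono exp_ge_add_one_self) (auto simp: r_def)
    also have "\<dots> \<le> exp (real l * r n) ^ n"
      by (intro power_increasing) (auto simp: r_def)
    also have "\<dots> = exp (real l * (real n * r n))"
      by (simp add: mult_ac flip: exp_of_nat_mult)
    finally have "real (Suc l) * (1 + real l * r n) ^ (n - Suc l)
        \<le> real (Suc l) * exp (real l * (real n * r n))"
      by (intro mult_left_mono) auto
    with prob_no_chain_path_le show ?case
      unfolding constant_crossings_def deviation_weight_def r_def by linarith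
  qed
  have "(\<lambda>n. (1/2::real) ^ (n - Suc l)) \<longlonglongrightarrow> 0"
    by (rule LIMSEQ_offset[of _ "Suc l"]) (simp add: LIMSEQ_power_zero)
  then show "(\<lambda>n. real (Suc l) - real (Suc l) * real l * (1/2) ^ (n - Suc l)) \<longlonglongrightarrow> real (Suc l)"
    by (auto intro!: tendsto_eq_intros)
  have "(\<lambda>n. real n * r n) \<longlonglongrightarrow> 0"
    unfolding r_def by real_asymp
  then have "(\<lambda>n. real (Suc l) * exp (real l * (real n * r n))) \<longlonglongrightarrow> real (Suc l) * exp (real l * 0)"
    by (intro tendsto_intros)
  then show "(\<lambda>n. real (Suc l) * exp (real l * (real n * r n))) \<longlonglongrightarrow> real (Suc l)"
    by simp
qed

lemma tendsto_scaled_prob_no_path: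
  fixes u w :: "nat \<Rightarrow> nat"
  assumes "\<And>n. n \<ge> 3 \<Longrightarrow> u n \<in> {1..n} \<and> w n \<in> {1..n} \<and> u n \<noteq> w n"
  shows "(\<lambda>n. 2 ^ (n - 1) * measure_pmf.prob (random_orientation n) (no_path_event n (u n) (w n)))
    \<longlonglongrightarrow> 2"
proof -
  define v where "v n i = (if i = 0 then u n else w n)" for n i :: nat
  have chain: "vertex_chain n 1 (v n)" if "n \<ge> 3" for n
    using assms[OF that] by unfold_locales (auto simp: v_def inj_on_def)
  have eq: "vertex_chain.no_chain_path n 1 (v n) = no_path_event n (u n) (w n)" if "n \<ge> 3" for n
    using vertex_chain.no_chain_path_def[OF chain[OF that]] by (simp add: v_def lessThan_Suc)
  have "(\<lambda>n. 2 ^ ((1 choose 2) + 1 * (n - 1))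
      * measure_pmf.prob (random_orientation n) (vertex_chain.no_chain_path n 1 (v n))) \<longlonglongrightarrow> real (Suc 1)"
    by (intro tendsto_scaled_prob_no_chain_path eventually_sequentiallyI[of 3] chain)
  then have *: "(\<lambda>n. 2 ^ ((1 choose 2) + 1 * (n - 1))
      * measure_pmf.prob (random_orientation n) (vertex_chain.no_chain_path n 1 (v n))) \<longlonglongrightarrow> 2"
    by simp
  have "(1 choose 2) + 1 * (n - 1) = n - 1" for n :: nat
    by (simp add: binomial_eq_0)
  then show ?thesis
    by (intro Lim_transform_eventually[OF *] eventually_sequentiallyI[of 3]) (simp only: eq)
qed

lemma tendsto_scaled_prob_two_blocked_steps:
  fixes a s b :: "nat \<Rightarrow> nat"
  assumes "\<And>n. n \<ge> 3 \<Longrightarrow> a n \<in> {1..n} \<and> s n \<in> {1..n} \<and> b n \<in> {1..n}"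
    and "\<And>n. n \<ge> 3 \<Longrightarrow> a n \<noteq> s n \<and> s n \<noteq> b n \<and> a n \<noteq> b n"
  shows "(\<lambda>n. 2 ^ (2 * n - 3) * measure_pmf.prob (random_orientation n)
      (no_path_event n (a n) (s n) \<inter> no_path_event n (s n) (b n))) \<longlonglongrightarrow> 3"
proof -
  define v where "v n i = (if i = 0 then a n else if i = 1 then s n else b n)" for n i :: nat
  have chain: "vertex_chain n 2 (v n)" if "n \<ge> 3" for n
  proof
    show "v n i \<in> {1..n}" if "i \<le> 2" for i
      using assms(1)[OF \<open>n \<ge> 3\<close>] by (auto simp: v_def)
    have "{..2::nat} = {0, 1, 2}" by auto
    then show "inj_on (v n) {..2}" using assms(2)[OF \<open>n \<ge> 3\<close>] by (auto simp: v_def inj_on_def)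
  qed
  have eq: "vertex_chain.no_chain_path n 2 (v n)
      = no_path_event n (a n) (s n) \<inter> no_path_event n (s n) (b n)" if "n \<ge> 3" for n
  proof -
    have "{..<2::nat} = {0, 1}" by auto
    then show ?thesis by (simp add: vertex_chain.no_chain_path_def[OF chain[OF that]] v_def)
  qed
  have "(\<lambda>n. 2 ^ ((2 choose 2) + 2 * (n - 2))
      * measure_pmf.prob (random_orientation n) (vertex_chain.no_chain_path n 2 (v n))) \<longlonglongrightarrow> real (Suc 2)"
    by (intro tendsto_scaled_prob_no_chain_path eventually_sequentiallyI[of 3] chain)
  then have *: "(\<lambda>n. 2 ^ ((2 choose 2) + 2 * (n - 2))
      * measure_pmf.prob (random_orientation n) (vertex_chain.no_chain_path n 2 (v n))) \<longlonglongrightarrow> 3"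
    by simp
  have "(2 choose 2) + 2 * (n - 2) = 2 * n - 3" if "n \<ge> 3" for n :: nat
    using that by simp
  then show ?thesis
    by (intro Lim_transform_eventually[OF *] eventually_sequentiallyI[of 3]) (simp only: eq)
qed

theorem theorem3p8:
  fixes a s b :: "nat \<Rightarrow> nat"
    and P :: "nat \<Rightarrow> (nat set \<Rightarrow> nat) set \<Rightarrow> real"
    and A B :: "nat \<Rightarrow> (nat set \<Rightarrow> nat) set"
  assumes vertices: "\<And>n. n \<ge> 3 \<Longrightarrow> a n \<in> {1..n} \<and> s n \<in> {1..n} \<and> b n \<in> {1..n}"
    and dist: "\<And>n. n \<ge> 3 \<Longrightarrow> a n \<noteq> s n \<and> s n \<noteq> b n \<and> a n \<noteq> b n"
  defines "P \<equiv> \<lambda>n. measure_pmf.prob (random_orientation n)"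
    and "A \<equiv> \<lambda>n. no_path_event n (a n) (s n)"
    and "B \<equiv> \<lambda>n. no_path_event n (s n) (b n)"
  shows "(\<lambda>n. (P n (A n \<inter> B n) - P n (A n) * P n (B n)) / P n (A n \<inter> B n)) \<longlonglongrightarrow> 1 / 3"
proof -
  have A: "(\<lambda>n. 2 ^ (n - 1) * P n (A n)) \<longlonglongrightarrow> 2"
    unfolding P_def A_def by (rule tendsto_scaled_prob_no_path) (use vertices dist in auto)
  have B: "(\<lambda>n. 2 ^ (n - 1) * P n (B n)) \<longlonglongrightarrow> 2"
    unfolding P_def B_def by (rule tendsto_scaled_prob_no_path) (use vertices dist in auto)
  have AB: "(\<lambda>n. 2 ^ (2 * n - 3) * P n (A n \<inter> B n)) \<longlonglongrightarrow> 3"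
    unfolding P_def A_def B_def
    by (rule tendsto_scaled_prob_two_blocked_steps) (use vertices dist in auto)
  have "(\<lambda>n. 1 - (2 ^ (n - 1) * P n (A n)) * (2 ^ (n - 1) * P n (B n))
      / (2 * (2 ^ (2 * n - 3) * P n (A n \<inter> B n)))) \<longlonglongrightarrow> 1 - 2 * 2 / (2 * 3)"
    by (intro tendsto_intros A B AB) simp
  then have lim: "(\<lambda>n. 1 - (2 ^ (n - 1) * P n (A n)) * (2 ^ (n - 1) * P n (B n))
      / (2 * (2 ^ (2 * n - 3) * P n (A n \<inter> B n)))) \<longlonglongrightarrow> 1 / 3"
    by simp
  have pos: "\<forall>\<^sub>F n in sequentially. 0 < 2 ^ (2 * n - 3) * P n (A n \<inter> B n)"
    by (rule order_tendstoD(1)[OF AB]) simp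
  have "\<forall>\<^sub>F n in sequentially. 1 - (2 ^ (n - 1) * P n (A n)) * (2 ^ (n - 1) * P n (B n))
      / (2 * (2 ^ (2 * n - 3) * P n (A n \<inter> B n)))
    = (P n (A n \<inter> B n) - P n (A n) * P n (B n)) / P n (A n \<inter> B n)"
    using pos eventually_ge_at_top[of 3]
  proof eventually_elim
    case (elim n)
    have "(n - 1) + (n - 1) = Suc (2 * n - 3)" using elim(2) by simp
    then have pow: "(2::real) ^ (n - 1) * 2 ^ (n - 1) = 2 * 2 ^ (2 * n - 3)"
      by (simp only: power_add[symmetric] power_Suc[symmetric])
    have "(2 ^ (n - 1) * P n (A n)) * (2 ^ (n - 1) * P n (B n))
        / (2 * (2 ^ (2 * n - 3) * P n (A n \<inter> B n)))
      = (2 ^ (n - 1) * 2 ^ (n - 1)) / (2 * 2 ^ (2 * n - 3))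
        * (P n (A n) * P n (B n) / P n (A n \<inter> B n))"
      by (simp add: mult_ac)
    also have "\<dots> = P n (A n) * P n (B n) / P n (A n \<inter> B n)"
      unfolding pow by simp
    finally have "(2 ^ (n - 1) * P n (A n)) * (2 ^ (n - 1) * P n (B n))
        / (2 * (2 ^ (2 * n - 3) * P n (A n \<inter> B n)))
      = P n (A n) * P n (B n) / P n (A n \<inter> B n)" .
    with elim(1) show ?case by (simp only: diff_divide_distrib) (simp add: zero_less_mult_iff)
  qed
  with lim show ?thesis by (rule Lim_transform_eventually)
qed

end
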